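(* Let $\alpha>0$ and $s>0$. The recurrence coefficients $\alpha_n,\beta_n$ and the quantities $a_n,b_n$ satisfy the Toda-type differential-difference equations $$s\frac{d}{ds}\ln\beta_n=a_{n-1}-a_n,\qquad n\ge1,$$ $$s\frac{d\alpha_n}{ds}=s\frac{da_n}{ds}=b_n-b_{n+1}=\beta_n-\beta_{n+1}+\alpha_n,\qquad n\ge1.$$
   Context: Fix $\alpha>0$. For $s>0$ let $w(x,s)=x^{\alpha}e^{-x-s/x}$ on $(0,\infty)$. Let $P_n(x)=P_n(x,s)$, $n\ge0$, be the monic polynomials of degree $n$ with $\int_0^\infty P_jP_k\,w(x,s)\,dx=h_j(s)\delta_{jk}$. The recurrence coefficients $\alpha_n(s)$ and $\beta_n(s)=h_n/h_{n-1}$ ($n\ge1$) are defined by $zP_n(z)=P_{n+1}(z)+\alpha_nP_n(z)+\beta_nP_{n-1}(z)$ (the subscripted $\alpha_n$ is not to be confused with the parameter $\alpha$). Define $$a_n(s):=\frac{s}{h_n}\int_0^\infty\frac{P_n(y)^2}{y}\,w(y,s)\,dy\ (n\ge0),\qquad b_n(s):=\frac{s}{h_{n-1}}\int_0^\infty\frac{P_n(y)P_{n-1}(y)}{y}\,w(y,s)\,dy\ (n\ge1).$$ *)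

theory Defs
  imports "HOL-Analysis.Analysis" "HOL-Computational_Algebra.Polynomial"
begin

definition weight :: "real \<Rightarrow> real \<Rightarrow> real \<Rightarrow> real" where
  "weight \<alpha> s x = x powr \<alpha> * exp (- x - s / x)"

definition monic_orthogonal :: "real \<Rightarrow> real \<Rightarrow> (nat \<Rightarrow> real poly) \<Rightarrow> bool" where
  "monic_orthogonal \<alpha> s P \<longleftrightarrow>
     (\<forall>n. degree (P n) = n \<and> lead_coeff (P n) = 1) \<and>
     (\<exists>h :: nat \<Rightarrow> real. \<forall>j k.
        (LINT x:{0<..}|lborel. poly (P j) x * poly (P k) x * weight \<alpha> s x)
          = (if j = k then h j else 0))"

text \<open>The description is proper for every \<open>\<alpha> > 0\<close> and \<open>s > 0\<close>: the weight is then positive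
  on the half-line and has moments of every order, so the monic orthogonal sequence exists
  and is unique.\<close>

definition orth_poly :: "real \<Rightarrow> real \<Rightarrow> nat \<Rightarrow> real poly" where
  "orth_poly \<alpha> s = (THE P. monic_orthogonal \<alpha> s P)"

definition norm_h :: "real \<Rightarrow> real \<Rightarrow> nat \<Rightarrow> real" where
  "norm_h \<alpha> s n = (LINT x:{0<..}|lborel. (poly (orth_poly \<alpha> s n) x)\<^sup>2 * weight \<alpha> s x)"

text \<open>Only meaningful for \<open>n \<ge> 1\<close>, because of the truncated subtraction; the same applies to
  \<open>aux_b\<close> below.\<close>

definition rec_beta :: "real \<Rightarrow> real \<Rightarrow> nat \<Rightarrow> real" where
  "rec_beta \<alpha> s n = norm_h \<alpha> s n / norm_h \<alpha> s (n - 1)"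

text \<open>At \<open>n = 0\<close> the recurrence is read with the usual convention that the term involving
  the polynomial of index \<open>-1\<close> vanishes.\<close>

definition rec_alpha :: "real \<Rightarrow> real \<Rightarrow> nat \<Rightarrow> real" where
  "rec_alpha \<alpha> s n = (THE c.
     [:0, 1:] * orth_poly \<alpha> s n
       = orth_poly \<alpha> s (n + 1) + smult c (orth_poly \<alpha> s n)
         + (if n = 0 then 0 else smult (rec_beta \<alpha> s n) (orth_poly \<alpha> s (n - 1))))"

definition aux_a :: "real \<Rightarrow> real \<Rightarrow> nat \<Rightarrow> real" where
  "aux_a \<alpha> s n = s / norm_h \<alpha> s n *
     (LINT y:{0<..}|lborel. (poly (orth_poly \<alpha> s n) y)\<^sup>2 / y * weight \<alpha> s y)"

definition aux_b :: "real \<Rightarrow> real \<Rightarrow> nat \<Rightarrow> real" where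
  "aux_b \<alpha> s n = s / norm_h \<alpha> s (n - 1) *
     (LINT y:{0<..}|lborel.
        poly (orth_poly \<alpha> s n) y * poly (orth_poly \<alpha> s (n - 1)) y / y * weight \<alpha> s y)"

end

(*
Write w_c for the weight with exponent c and let p(n) be the coefficient of x^(n-1) in P_n. Since
d/ds w_c = - w_(c-1), differentiating h_n = <P_n, P_n> and 0 = <P_n, P_(n-1)> gives
s (ln h_n)' = - a_n and s p(n)' = b_n, because dP_n/ds has degree less than n. With
beta_n = h_n / h_(n-1) and alpha_n = p(n) - p(n+1), these are the Toda equations for ln beta_n and
alpha_n. Integrating d/dx (x w P_n^2) and d/dx (x w P_n P_(n-1)) over the half-line gives the algebraic
relations alpha_n = 2n + 1 + alpha + a_n and b_n = beta_n + p(n), whence the remaining equalities.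
*)

theory Submission
  imports Defs "HOL-Real_Asymp.Real_Asymp"
begin

section \<open>Moments of the weight\<close>

text \<open>The obstacle is to justify the derivatives in \<open>s\<close>: polynomial and weight
  move together, and the polynomials are given only by a definite description. A pairing of
  polynomials is therefore treated as a finite linear combination of moments. The analysis then
  shrinks to two facts about the scalar function \<open>moment c\<close>: its derivative in
  \<open>s\<close>, and one integration by parts, done once for pure powers. The exponent
  \<open>c\<close> ranges over all reals, because each division by y lowers it by 1 and the
  differentiability proof lowers it by 2; the factor exp(-s/x) keeps all these moments
  finite.\<close>

lemma weight_tendsto_at_right_0:
  assumes "s > 0"
  shows "(weight c s \<longlongrightarrow> 0) (at_right 0)"
  unfolding weight_def[abs_def] using assms by real_asymp

lemma weight_tendsto_at_top:
  "(weight c s \<longlongrightarrow> 0) at_top"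
  unfolding weight_def[abs_def] by real_asymp

text \<open>Half of the decay of exp(-x) is kept as an integrable majorant. The remaining factor
  \<open>f\<close> tends to 0 at both ends of the half-line and is continuous on the compact
  interval left between them, hence bounded above.\<close>

lemma weight_bound:
  assumes "s > 0"
  obtains K where "\<And>x. x > 0 \<Longrightarrow> weight c s x \<le> K * exp (- (x / 2))"
proof -
  define f where "f x = x powr c * exp (- (x / 2) - s / x)" for x :: real
  have f0: "(f \<longlongrightarrow> 0) (at_right 0)"
    unfolding f_def[abs_def] using assms by real_asymp
  have f1: "(f \<longlongrightarrow> 0) at_top"
    unfolding f_def[abs_def] by real_asymp
  have "eventually (\<lambda>x. f x < 1) (at_right 0)"
    using order_tendstoD(2)[OF f0, of 1] by simp
  then obtain a where a: "a > 0" "\<And>x. 0 < x \<Longrightarrow> x < a \<Longrightarrow> f x < 1"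
    by (auto simp: eventually_at_right_field)
  have "eventually (\<lambda>x. f x < 1) at_top"
    using order_tendstoD(2)[OF f1, of 1] by simp
  then obtain b where b: "\<And>x. x > b \<Longrightarrow> f x < 1"
    by (auto simp: eventually_at_top_dense)
  have "continuous_on {a..b} f"
    unfolding f_def[abs_def] using a by (intro continuous_intros) auto
  then have "bounded (f ` {a..b})"
    by (intro compact_imp_bounded compact_continuous_image) auto
  then obtain B where B: "\<And>x. x \<in> {a..b} \<Longrightarrow> \<bar>f x\<bar> \<le> B"
    by (force simp: bounded_iff)
  have le: "f x \<le> max 1 B" if "x > 0" for x
  proof (cases "x < a \<or> x > b")
    case True
    then show ?thesis using a(2)[of x] b[of x] that by (auto simp: max_def)
  next
    case False
    then show ?thesis using B[of x] by (auto simp: max_def)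
  qed
  have "weight c s x \<le> max 1 B * exp (- (x / 2))" if "x > 0" for x
  proof -
    have "weight c s x = f x * exp (- (x / 2))"
      by (simp add: weight_def f_def mult.assoc flip: exp_add)
    then show ?thesis using le[OF that] by (simp add: mult_right_mono)
  qed
  then show ?thesis by (rule that)
qed

lemma weight_measurable [measurable]: "weight c s \<in> borel_measurable borel"
  unfolding weight_def[abs_def] by measurable

lemma weight_pos: "x > 0 \<Longrightarrow> weight c s x > 0"
  by (simp add: weight_def)

lemma exp_half_integrable: "set_integrable lborel {0<..} (\<lambda>x::real. exp (- (x / 2)))"
proof -
  have "(\<lambda>x::real. exp (- (1/2) * x)) integrable_on {0..}"
    by (rule integrable_on_exp_minus_to_infinity) simp
  then have "(\<lambda>x::real. exp (- (x / 2))) absolutely_integrable_on {0..}"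
    by (intro nonnegative_absolutely_integrable_1) auto
  then have "(\<lambda>x::real. exp (- (x / 2))) absolutely_integrable_on {0<..}"
    by (rule set_integrable_subset) auto
  \<comment> \<open>\<open>absolutely_integrable_on\<close> refers to the completed measure; the
    integrand is Borel, so integrability descends to \<open>lborel\<close>.\<close>
  then show ?thesis
    by (simp add: set_integrable_def integrable_completion)
qed

lemma weight_integrable:
  assumes "s > 0" shows "set_integrable lborel {0<..} (weight c s)"
proof -
  obtain K where K: "\<And>x. x > 0 \<Longrightarrow> weight c s x \<le> K * exp (- (x / 2))"
    using weight_bound[OF assms] by blast
  show ?thesis
  proof (rule set_integrable_bound)
    show "set_integrable lborel {0<..} (\<lambda>x. K * exp (- (x / 2)))"
      by (intro set_integrable_mult_right exp_half_integrable)
    show "set_borel_measurable lborel {0<..} (weight c s)"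
      by (simp add: set_borel_measurable_def)
    have "norm (weight c s x) \<le> norm (K * exp (- (x / 2)))" if "x > 0" for x
      using K[OF that] weight_pos[OF that, of c s] by simp
    then show "AE x in lborel. x \<in> {0<..} \<longrightarrow> norm (weight c s x) \<le> norm (K * exp (- (x / 2)))"
      by auto
  qed
qed

text \<open>For s > 0 this is 2 s^((c+1)/2) K_(c+1)(2 sqrt s), with K the modified Bessel function
  of the second kind.\<close>

definition moment :: "real \<Rightarrow> real \<Rightarrow> real" where
  "moment c s = (LINT x:{0<..}|lborel. weight c s x)"

lemma weight_shift: "x > 0 \<Longrightarrow> weight (c - 1) s x = weight c s x / x"
  by (simp add: weight_def powr_diff)

lemma weight_shift': "x > 0 \<Longrightarrow> weight (c + 1) s x = weight c s x * x"
  by (simp add: weight_def powr_add)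

lemma weight_add_nat: "x > 0 \<Longrightarrow> weight (c + real i) s x = x ^ i * weight c s x"
  by (simp add: weight_def powr_add powr_realpow)

lemma weight_antimono: "x > 0 \<Longrightarrow> s \<le> t \<Longrightarrow> weight c t x \<le> weight c s x"
  by (auto simp: weight_def intro!: mult_left_mono divide_right_mono)

text \<open>Convexity in the parameter: exp(u) >= 1 + u at u = (s - t)/x, the slope of the tangent
  at s being minus the weight of exponent c - 1.\<close>

lemma weight_tangent:
  assumes "x > 0"
  shows "weight c t x - weight c s x \<ge> (s - t) * weight (c - 1) s x"
proof -
  have "exp (- x - t / x) = exp (- x - s / x) * exp ((s - t) / x)"
    using assms by (simp add: field_simps flip: exp_add)
  moreover have "exp ((s - t) / x) \<ge> 1 + (s - t) / x" by (rule exp_ge_add_one_self)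
  ultimately have "exp (- x - t / x) \<ge> exp (- x - s / x) * (1 + (s - t) / x)"
    by simp
  then have "x powr c * exp (- x - t / x) \<ge> x powr c * (exp (- x - s / x) * (1 + (s - t) / x))"
    by (intro mult_left_mono) auto
  then show ?thesis unfolding weight_shift[OF assms]
    by (simp add: weight_def algebra_simps)
qed

lemma moment_tangent:
  assumes "s > 0" "t > 0"
  shows "moment c t - moment c s \<ge> (s - t) * moment (c - 1) s"
proof -
  have "(LINT x:{0<..}|lborel. (s - t) * weight (c - 1) s x) \<le>
    (LINT x:{0<..}|lborel. weight c t x - weight c s x)"
    using assms by (intro set_integral_mono set_integrable_mult_right set_integral_diff(1)
      weight_integrable weight_tangent) auto
  then show ?thesis
    using assms by (simp add: moment_def set_integral_diff(2) weight_integrable)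
qed

lemma moment_antimono:
  assumes "0 < s" "s \<le> t"
  shows "moment c t \<le> moment c s"
  unfolding moment_def using assms
  by (intro set_integral_mono weight_integrable weight_antimono) auto

lemma moment_has_derivative:
  assumes s: "s > 0"
  shows "(moment c has_real_derivative - moment (c - 1) s) (at s)"
proof -
  \<comment> \<open>Moments decrease in the parameter, so the value at \<open>s / 2\<close>
    dominates those at every \<open>r \<ge> s / 2\<close>.\<close>
  define K where "K = moment (c - 1 - 1) (s / 2)"
  \<comment> \<open>\<open>moment c\<close> is convex in \<open>s\<close>: the tangents at \<open>s\<close> and at \<open>t\<close> bound the remainder by
    \<open>\<bar>t - s\<bar>\<close> times the variation of \<open>moment (c - 1)\<close>, to which the same argument applies.\<close>
  have bound: "\<bar>moment c t - moment c s + (t - s) * moment (c - 1) s\<bar> \<le> K * (t - s)\<^sup>2"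
    if t: "t > s / 2" for t
  proof -
    have t0: "t > 0" using s t by simp
    have Ku: "moment (c - 1 - 1) r \<le> K" if "r \<ge> s / 2" for r
      unfolding K_def using s that by (intro moment_antimono) auto
    have K: "\<bar>moment (c - 1) t - moment (c - 1) s\<bar> \<le> K * \<bar>t - s\<bar>"
    proof (cases "s \<le> t")
      case True
      have "(t - s) * moment (c - 1 - 1) s \<le> (t - s) * K"
        using True s by (intro mult_left_mono Ku) auto
      then show ?thesis
        using True moment_antimono[OF s True, of "c - 1"] moment_tangent[OF s t0, of "c - 1"]
        by (simp add: algebra_simps)
    next
      case False
      have "(s - t) * moment (c - 1 - 1) t \<le> (s - t) * K"
        using False t by (intro mult_left_mono Ku) auto
      then show ?thesis
        using False moment_antimono[OF t0, of s "c - 1"] moment_tangent[OF t0 s, of "c - 1"]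
        by (simp add: algebra_simps)
    qed
    have "\<bar>moment c t - moment c s + (t - s) * moment (c - 1) s\<bar>
        \<le> \<bar>(t - s) * (moment (c - 1) t - moment (c - 1) s)\<bar>"
      using moment_tangent[OF s t0, of c] moment_tangent[OF t0 s, of c]
      by (simp add: algebra_simps)
    also have "\<dots> = \<bar>t - s\<bar> * \<bar>moment (c - 1) t - moment (c - 1) s\<bar>" by (rule abs_mult)
    also have "\<dots> \<le> \<bar>t - s\<bar> * (K * \<bar>t - s\<bar>)" using K by (rule mult_left_mono) simp
    finally show ?thesis by (simp add: power2_eq_square mult_ac)
  qed
  have "((\<lambda>t. (moment c t - moment c s) / (t - s)) \<longlongrightarrow> - moment (c - 1) s) (at s)"
  proof (rule LIM_zero_cancel, rule Lim_null_comparison)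
    have "eventually (\<lambda>t. t > s / 2 \<and> t \<noteq> s) (at s)"
      using s by (intro eventually_conj order_tendstoD[OF tendsto_ident_at]
         eventually_neq_at_within) auto
    then show "\<forall>\<^sub>F t in at s. norm ((moment c t - moment c s) / (t - s) - - moment (c - 1) s)
        \<le> K * \<bar>t - s\<bar>"
    proof eventually_elim
      case (elim t)
      have "(moment c t - moment c s) / (t - s) - - moment (c - 1) s
        = (moment c t - moment c s + (t - s) * moment (c - 1) s) / (t - s)"
        using elim by (simp add: field_simps)
      also have "\<bar>\<dots>\<bar> \<le> K * (t - s)\<^sup>2 / \<bar>t - s\<bar>"
        unfolding abs_divide using elim bound[of t] by (intro divide_right_mono) auto
      also have "(t - s)\<^sup>2 = \<bar>t - s\<bar> * \<bar>t - s\<bar>" by (simp add: power2_eq_square)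
      also have "K * (\<bar>t - s\<bar> * \<bar>t - s\<bar>) / \<bar>t - s\<bar> = K * \<bar>t - s\<bar>"
        using elim by (simp del: abs_mult_self_eq)
      finally show ?case by simp
    qed
    show "((\<lambda>t. K * \<bar>t - s\<bar>) \<longlongrightarrow> 0) (at s)"
      by (intro tendsto_eq_intros refl) auto
  qed
  then show ?thesis by (simp add: has_field_derivative_iff)
qed

lemma moment_recurrence:
  assumes "s > 0"
  shows "(c + 1) * moment c s - moment (c + 1) s + s * moment (c - 1) s = 0"
proof -
  \<comment> \<open>\<open>f\<close> is the derivative of \<open>weight (c + 1) s\<close>, which vanishes at both ends of the half-line.\<close>
  define f where "f x = (c + 1) * weight c s x - weight (c + 1) s x + s * weight (c - 1) s x" for x
  have int: "set_integrable lborel {0<..} f"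
    unfolding f_def[abs_def] using assms
    by (intro set_integral_add(1) set_integral_diff(1) set_integrable_mult_right weight_integrable)
  have deriv: "(weight (c + 1) s has_real_derivative f x) (at x)" if "x > 0" for x
  proof -
    have "((\<lambda>x. x powr (c + 1) * exp (- x - s / x)) has_real_derivative
       (c + 1) * x powr (c + 1 - 1) * exp (- x - s / x) +
        x powr (c + 1) * (exp (- x - s / x) * (- 1 + s / x\<^sup>2))) (at x)"
      using that by (auto intro!: derivative_eq_intros simp: power2_eq_square field_simps)
    also have "(c + 1) * x powr (c + 1 - 1) * exp (- x - s / x) +
        x powr (c + 1) * (exp (- x - s / x) * (- 1 + s / x\<^sup>2)) = f x"
      using that unfolding f_def weight_shift[OF that] weight_shift'[OF that]
      by (simp add: weight_def powr_add field_simps power2_eq_square)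
    finally show ?thesis by (simp add: weight_def[abs_def])
  qed
  have "(LBINT x=0..\<infinity>. f x) = 0 - 0"
  proof (rule interval_integral_FTC_integrable[where F = "weight (c + 1) s"])
    show "(weight (c + 1) s has_vector_derivative f x) (at x)"
      if "0 < ereal x" "ereal x < \<infinity>" for x
      using deriv[of x] that by (simp add: has_real_derivative_iff_has_vector_derivative)
    show "isCont f x" if "0 < ereal x" "ereal x < \<infinity>" for x
      unfolding f_def[abs_def] weight_def[abs_def] using that
      by (intro continuous_intros) auto
    show "set_integrable lborel (einterval 0 \<infinity>) f"
      using int by (simp add: zero_ereal_def)
    show "((weight (c + 1) s \<circ> real_of_ereal) \<longlongrightarrow> 0) (at_right 0)"
      using weight_tendsto_at_right_0[OF assms, of "c + 1"]
      by (simp add: zero_ereal_def ereal_tendsto_simps)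
    show "((weight (c + 1) s \<circ> real_of_ereal) \<longlongrightarrow> 0) (at_left \<infinity>)"
      using weight_tendsto_at_top[of "c + 1" s] by (simp add: ereal_tendsto_simps)
  qed simp
  then have "(LINT x:{0<..}|lborel. f x) = 0"
    by (simp add: interval_lebesgue_integral_def zero_ereal_def)
  moreover have "(LINT x:{0<..}|lborel. f x) =
      (c + 1) * moment c s - moment (c + 1) s + s * moment (c - 1) s"
    unfolding f_def[abs_def] moment_def using assms
    by (simp add: set_integral_add(2) set_integral_diff weight_integrable)
  ultimately show ?thesis by simp
qed

section \<open>The moment functional\<close>

text \<open>A finite sum instead of an integral, so that differentiation in \<open>s\<close> acts
  term by term. Keeping \<open>c\<close> as an argument lets division by x be expressed as a shift
  to \<open>c - 1\<close> with the polynomial unchanged.\<close>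

definition moment_functional :: "real \<Rightarrow> real \<Rightarrow> real poly \<Rightarrow> real" where
  "moment_functional c s p = (\<Sum>i\<le>degree p. coeff p i * moment (c + real i) s)"

text \<open>Any degree bound serves as summation range, so several polynomials, or a whole family in
  \<open>s\<close>, can share one.\<close>

lemma moment_functional_altdef:
  assumes "degree p \<le> N"
  shows "moment_functional c s p = (\<Sum>i\<le>N. coeff p i * moment (c + real i) s)"
  unfolding moment_functional_def using assms
  by (intro sum.mono_neutral_left) (auto simp: coeff_eq_0)

lemma moment_functional_0 [simp]: "moment_functional c s 0 = 0"
  by (simp add: moment_functional_def)

lemma moment_functional_add:
  "moment_functional c s (p + q) = moment_functional c s p + moment_functional c s q"
proof -
  define N where "N = max (degree p) (degree q)"
  have "degree p \<le> N" "degree q \<le> N" "degree (p + q) \<le> N"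
    by (auto simp: N_def degree_add_le_max)
  then show ?thesis
    by (simp add: moment_functional_altdef[where N = N] sum.distrib algebra_simps)
qed

lemma moment_functional_smult:
  "moment_functional c s (smult a p) = a * moment_functional c s p"
  by (simp add: moment_functional_altdef[where N = "degree p"] degree_smult_le
      sum_distrib_left mult.assoc)

lemma moment_functional_diff:
  "moment_functional c s (p - q) = moment_functional c s p - moment_functional c s q"
  using moment_functional_add[of c s "p - q" q] by simp

lemma moment_functional_integral:
  assumes "s > 0"
  shows "set_integrable lborel {0<..} (\<lambda>x. poly p x * weight c s x)"
    and "(LINT x:{0<..}|lborel. poly p x * weight c s x) = moment_functional c s p"
proof -
  have eq: "indicator {0<..} x *\<^sub>R (poly p x * weight c s x) =
    (\<Sum>i\<le>degree p. coeff p i *\<^sub>R (indicator {0<..} x *\<^sub>R weight (c + real i) s x))" for x :: real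
    by (cases "x > 0") (auto simp: poly_altdef sum_distrib_right weight_add_nat mult.assoc)
  have int: "integrable lborel (\<lambda>x. indicator {0<..} x *\<^sub>R weight (c + real i) s x)" for i
    using weight_integrable[OF assms] by (simp add: set_integrable_def)
  show "set_integrable lborel {0<..} (\<lambda>x. poly p x * weight c s x)"
    unfolding set_integrable_def eq
    by (intro Bochner_Integration.integrable_sum integrable_scaleR_right int)
  show "(LINT x:{0<..}|lborel. poly p x * weight c s x) = moment_functional c s p"
    unfolding set_lebesgue_integral_def eq
    by (subst Bochner_Integration.integral_sum, intro integrable_scaleR_right int)
       (simp only: integral_scaleR_right moment_functional_def moment_def set_lebesgue_integral_def,
        simp)
qed

text \<open>Otherwise a nonnegative integrand would have integral 0 and vanish almost everywhere;
  off the finitely many roots of \<open>p\<close> it is positive on the half-line, so the unit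
  interval would be a null set.\<close>

lemma moment_functional_square_pos:
  assumes s: "s > 0" and p: "p \<noteq> 0"
  shows "moment_functional c s (p * p) > 0"
proof (rule ccontr)
  assume neg: "\<not> moment_functional c s (p * p) > 0"
  define f where "f x = indicator {0<..} x *\<^sub>R (poly (p * p) x * weight c s x)" for x :: real
  have f_nonneg: "f x \<ge> 0" for x
    by (auto simp: f_def indicator_def less_imp_le[OF weight_pos])
  have int: "integrable lborel f"
    using moment_functional_integral(1)[OF s] unfolding set_integrable_def f_def[abs_def] .
  have eq: "integral\<^sup>L lborel f = moment_functional c s (p * p)"
    using moment_functional_integral(2)[OF s] unfolding set_lebesgue_integral_def f_def[abs_def] .
  have "integral\<^sup>L lborel f \<ge> 0"
    by (intro integral_nonneg_AE AE_I2 f_nonneg)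
  then have "integral\<^sup>L lborel f = 0" using neg eq by simp
  then have "AE x in lborel. f x = 0"
    using integral_nonneg_eq_0_iff_AE[OF int] f_nonneg by simp
  moreover have "AE x in lborel. x \<notin> {x. poly p x = 0}"
    using poly_roots_finite[OF p] by (intro AE_not_in finite_imp_null_set_lborel)
  ultimately have "AE x in lborel. x \<notin> {0<..<1::real}"
  proof eventually_elim
    case (elim x)
    then show ?case using weight_pos[of x c s] by (auto simp: f_def indicator_def)
  qed
  then have "emeasure lborel {0<..<1::real} = 0"
    by (subst (asm) AE_iff_measurable[where N = "{0<..<1}"]) auto
  then show False by simp
qed

lemma moment_functional_pCons_0:
  "moment_functional c s (pCons 0 p) = moment_functional (c + 1) s p"
proof -
  have "moment_functional c s (pCons 0 p) =
      (\<Sum>i\<le>Suc (degree p). coeff (pCons 0 p) i * moment (c + real i) s)"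
    by (rule moment_functional_altdef) (simp add: degree_pCons_le)
  also have "\<dots> = moment_functional (c + 1) s p"
    by (subst sum.atMost_Suc_shift) (simp add: moment_functional_def add_ac)
  finally show ?thesis .
qed

lemma coeff_pCons_0_pderiv: "coeff (pCons 0 (pderiv p)) i = of_nat i * coeff p i"
  by (cases i) (simp_all add: coeff_pderiv)

text \<open>This is the vanishing integral of d/dx (x p w). The operator x d/dx is diagonal on
  monomials, so the identity splits into copies of \<open>moment_recurrence\<close> at the exponents
  c + i.\<close>

lemma moment_functional_by_parts:
  assumes "s > 0"
  shows "moment_functional c s (pCons 0 (pderiv p)) + (c + 1) * moment_functional c s p
     - moment_functional c s (pCons 0 p) + s * moment_functional (c - 1) s p = 0"
proof -
  have "degree (pCons 0 (pderiv p)) \<le> degree p"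
    by (intro degree_le) (auto simp: coeff_pCons_0_pderiv coeff_eq_0)
  then have "moment_functional c s (pCons 0 (pderiv p)) =
      (\<Sum>i\<le>degree p. real i * coeff p i * moment (c + real i) s)"
    by (subst moment_functional_altdef) (auto simp only: coeff_pCons_0_pderiv)
  then have "moment_functional c s (pCons 0 (pderiv p)) + (c + 1) * moment_functional c s p
     - moment_functional c s (pCons 0 p) + s * moment_functional (c - 1) s p =
     (\<Sum>i\<le>degree p. coeff p i * ((c + real i + 1) * moment (c + real i) s
        - moment (c + real i + 1) s + s * moment (c + real i - 1) s))"
    unfolding moment_functional_pCons_0
    by (simp add: moment_functional_def sum_distrib_left algebra_simps
        flip: sum.distrib sum_subtractf)
  also have "\<dots> = 0"
    by (simp only: moment_recurrence[OF assms] mult_zero_right sum.neutral_const)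
  finally show ?thesis .
qed

section \<open>Orthogonal polynomials\<close>

text \<open>The monic orthogonal polynomials, generated by their three-term recurrence so that smoothness in
  \<open>s\<close> can be proved by induction on the degree.\<close>

fun mop :: "real \<Rightarrow> real \<Rightarrow> nat \<Rightarrow> real poly" where
  "mop c s 0 = 1"
| "mop c s (Suc n) = pCons 0 (mop c s n)
     - smult (moment_functional c s (pCons 0 (mop c s n * mop c s n))
              / moment_functional c s (mop c s n * mop c s n)) (mop c s n)
     - (if n = 0 then 0
        else smult (moment_functional c s (mop c s n * mop c s n)
                    / moment_functional c s (mop c s (n - 1) * mop c s (n - 1)))
               (mop c s (n - 1)))"

definition mop_norm :: "real \<Rightarrow> real \<Rightarrow> nat \<Rightarrow> real" where
  "mop_norm c s n = moment_functional c s (mop c s n * mop c s n)"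

definition mop_alpha :: "real \<Rightarrow> real \<Rightarrow> nat \<Rightarrow> real" where
  "mop_alpha c s n = moment_functional c s (pCons 0 (mop c s n * mop c s n)) / mop_norm c s n"

text \<open>The value 0 at \<open>n = 0\<close> removes the spurious term
  \<open>mop c s (0 - 1)\<close>, which is \<open>mop c s 0\<close>, so that \<open>mop_Suc\<close>
  has one form for all \<open>n\<close>.\<close>

definition mop_beta :: "real \<Rightarrow> real \<Rightarrow> nat \<Rightarrow> real" where
  "mop_beta c s n = (if n = 0 then 0 else mop_norm c s n / mop_norm c s (n - 1))"

lemma mop_Suc: "mop c s (Suc n) = pCons 0 (mop c s n) - smult (mop_alpha c s n) (mop c s n)
    - smult (mop_beta c s n) (mop c s (n - 1))"
  by (simp add: mop_alpha_def mop_beta_def mop_norm_def)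

declare mop.simps(2) [simp del]

text \<open>The leading term comes from \<open>pCons 0\<close> alone, whatever the recurrence
  coefficients are. This gives the result at every real \<open>s\<close>, as
  \<open>mop_derivative_coeff\<close> requires.\<close>

lemma mop_monic: "degree (mop c s n) \<le> n \<and> coeff (mop c s n) n = 1"
proof (induction n rule: less_induct)
  case (less n)
  show ?case
  proof (cases n)
    case (Suc m)
    have m: "degree (mop c s m) \<le> m" "coeff (mop c s m) m = 1" "degree (mop c s (m - 1)) \<le> m"
      using less[of m] less[of "m - 1"] Suc by fastforce+
    then have "degree (mop c s n) \<le> n"
      unfolding Suc mop_Suc
      by (intro degree_diff_le order_trans[OF degree_pCons_le] order_trans[OF degree_smult_le]) auto
    moreover have "coeff (mop c s n) n = 1"
      using m by (simp add: Suc mop_Suc coeff_eq_0)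
    ultimately show ?thesis by simp
  qed auto
qed

lemma coeff_mop_same [simp]: "coeff (mop c s n) n = 1"
  using mop_monic by blast

lemma degree_mop [simp]: "degree (mop c s n) = n"
  using mop_monic[of c s n] by (intro antisym le_degree) auto

lemma mop_nonzero [simp]: "mop c s n \<noteq> 0"
  using coeff_mop_same[of c s n] by (metis coeff_0 zero_neq_one)

lemma mop_norm_pos: "s > 0 \<Longrightarrow> mop_norm c s n > 0"
  unfolding mop_norm_def by (intro moment_functional_square_pos) auto

lemmas moment_functional_linear =
  moment_functional_add moment_functional_diff moment_functional_smult

text \<open>In the pairing of Q_(n+1) with Q_k the factor x can be moved from Q_n to Q_k. For k = n
  the choice of \<open>mop_alpha\<close> gives cancellation, for k = n - 1 that of
  \<open>mop_beta\<close>, and for smaller k all terms vanish by induction.\<close>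

lemma mop_orthogonal_aux:
  assumes s: "s > 0"
  shows "\<forall>j\<le>n. \<forall>k<j. moment_functional c s (mop c s j * mop c s k) = 0"
proof (induction n)
  case (Suc n)
  define L where "L = moment_functional c s"
  let ?Q = "mop c s"
  have IH: "L (?Q j * ?Q k) = 0" if "j \<le> n" "k \<le> n" "j \<noteq> k" for j k
    using Suc.IH that by (cases "k < j") (auto simp: L_def mult.commute)
  have norm: "L (?Q j * ?Q j) = mop_norm c s j" for j
    by (simp add: L_def mop_norm_def)
  have norm0: "mop_norm c s j \<noteq> 0" for j
    using mop_norm_pos[OF s, of c j] by simp
  have "L (?Q (Suc n) * ?Q k) = 0" if k: "k \<le> n" for k
  proof -
    have "L (?Q (Suc n) * ?Q k) = L (?Q n * pCons 0 (?Q k)) - mop_alpha c s n * L (?Q n * ?Q k)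
        - mop_beta c s n * L (?Q (n - 1) * ?Q k)"
      by (simp add: mop_Suc L_def left_diff_distrib moment_functional_linear)
    also have "\<dots> = 0"
    proof (cases "k = n")
      case True
      have "mop_beta c s n * L (?Q (n - 1) * ?Q n) = 0"
        using IH[of "n - 1" n] by (cases "n = 0") (auto simp: mop_beta_def)
      moreover have "L (?Q n * pCons 0 (?Q n)) = mop_alpha c s n * mop_norm c s n"
        using norm0[of n] by (simp add: mop_alpha_def L_def)
      ultimately show ?thesis
        using True by (simp add: norm)
    next
      case False
      then have kn: "k < n" using k by simp
      have x: "pCons 0 (?Q k) = ?Q (Suc k) + smult (mop_alpha c s k) (?Q k)
          + smult (mop_beta c s k) (?Q (k - 1))"
        by (simp add: mop_Suc)
      have "L (?Q n * pCons 0 (?Q k)) = L (?Q n * ?Q (Suc k)) + mop_alpha c s k * L (?Q n * ?Q k)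
          + mop_beta c s k * L (?Q n * ?Q (k - 1))"
        unfolding x by (simp add: L_def distrib_left moment_functional_linear)
      also have "\<dots> = L (?Q n * ?Q (Suc k))"
        using kn by (simp add: IH)
      also have "\<dots> = mop_beta c s n * L (?Q (n - 1) * ?Q k)"
      proof (cases "Suc k = n")
        case True
        then show ?thesis
          using norm0[of k] by (auto simp: norm mop_beta_def)
      next
        case False
        then show ?thesis using kn by (simp add: IH)
      qed
      finally show ?thesis using kn by (simp add: IH)
    qed
    finally show ?thesis .
  qed
  then show ?case
    using Suc.IH by (auto simp: L_def le_Suc_eq)
qed auto

lemma mop_orthogonal:
  assumes "s > 0" "j \<noteq> k"
  shows "moment_functional c s (mop c s j * mop c s k) = 0"
  using mop_orthogonal_aux[OF assms(1), of "max j k" c] assms(2)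
  by (cases "k < j") (auto simp: mult.commute)

text \<open>Stated for an arbitrary monic orthogonal sequence, because the uniqueness proof applies
  it to an unknown one. Bounding \<open>q\<close> through its coefficients makes k = 0 force q = 0,
  which starts the induction; each step peels off a multiple of \<open>P k\<close>.\<close>

lemma orthogonal_lower_degree:
  fixes P :: "nat \<Rightarrow> real poly"
  assumes monic: "\<And>n. degree (P n) = n" "\<And>n. lead_coeff (P n) = 1"
    and orth: "\<And>j k. j \<noteq> k \<Longrightarrow> moment_functional c s (P j * P k) = 0"
    and "\<And>i. i \<ge> k \<Longrightarrow> coeff q i = 0" and "k \<le> n"
  shows "moment_functional c s (q * P n) = 0"
  using assms(4,5)
proof (induction k arbitrary: q)
  case 0
  then have "q = 0" by (intro poly_eqI) auto
  then show ?case by simp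
next
  case (Suc k)
  define r where "r = q - smult (coeff q k) (P k)"
  have "coeff r i = 0" if "i \<ge> k" for i
  proof (cases "i = k")
    case True
    then show ?thesis using monic(1)[of k] monic(2)[of k] by (simp add: r_def)
  next
    case False
    then show ?thesis using that Suc.prems(1)[of i] monic(1)[of k] by (simp add: r_def coeff_eq_0)
  qed
  then have "moment_functional c s (r * P n) = 0"
    using Suc by simp
  moreover have "q * P n = r * P n + smult (coeff q k) (P k * P n)"
    by (simp add: r_def algebra_simps)
  ultimately show ?case
    using orth[of k n] Suc.prems(2) by (simp add: moment_functional_linear)
qed

lemma mop_orthogonal_lower_degree:
  assumes "s > 0" "\<And>i. i \<ge> n \<Longrightarrow> coeff q i = 0"
  shows "moment_functional c s (q * mop c s n) = 0"
  by (rule orthogonal_lower_degree[where k = n]) (use assms in \<open>auto intro: mop_orthogonal\<close>)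

text \<open>Pairing with P_n reads off the coefficient of x^n, since the rest of \<open>q\<close> is
  orthogonal to P_n. This evaluates the pairings in the algebraic relations below.\<close>

lemma mop_leading_part:
  assumes "s > 0" "\<And>i. i > n \<Longrightarrow> coeff q i = 0"
  shows "moment_functional c s (q * mop c s n) = coeff q n * mop_norm c s n"
proof -
  define r where "r = q - smult (coeff q n) (mop c s n)"
  have "coeff r i = 0" if "i \<ge> n" for i
    using that assms(2)[of i] by (cases "i = n") (auto simp: r_def coeff_eq_0)
  then have "moment_functional c s (r * mop c s n) = 0"
    using assms(1) by (rule mop_orthogonal_lower_degree[rotated])
  moreover have "q * mop c s n = r * mop c s n + smult (coeff q n) (mop c s n * mop c s n)"
    by (simp add: r_def algebra_simps)
  ultimately show ?thesis
    by (simp add: moment_functional_linear mop_norm_def)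
qed

section \<open>Identification with the quantities of the statement\<close>

lemma poly_product_integral:
  assumes "s > 0"
  shows "(LINT x:{0<..}|lborel. poly p x * poly q x * weight c s x) = moment_functional c s (p * q)"
  using moment_functional_integral(2)[OF assms, of "p * q"] by simp

lemma poly_product_integral_div:
  assumes "s > 0"
  shows "(LINT x:{0<..}|lborel. poly p x * poly q x / x * weight c s x)
    = moment_functional (c - 1) s (p * q)"
proof -
  have "(LINT x:{0<..}|lborel. poly p x * poly q x / x * weight c s x) =
    (LINT x:{0<..}|lborel. poly p x * poly q x * weight (c - 1) s x)"
    by (rule set_lebesgue_integral_cong) (auto simp: weight_shift)
  then show ?thesis by (simp add: poly_product_integral[OF assms])
qed

text \<open>Uniqueness: the difference \<open>d\<close> of two candidates of degree n has lower
  degree, hence is orthogonal to both, hence to itself, and positivity forces d = 0.\<close>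

lemma orth_poly_eq_mop:
  assumes s: "s > 0"
  shows "orth_poly c s = mop c s"
  unfolding orth_poly_def
proof (rule the_equality)
  show "monic_orthogonal c s (mop c s)"
    unfolding monic_orthogonal_def poly_product_integral[OF s]
    by (auto intro!: exI[of _ "mop_norm c s"] simp: mop_norm_def mop_orthogonal[OF s])
next
  fix P assume "monic_orthogonal c s P"
  then have monic: "\<And>n. degree (P n) = n" "\<And>n. lead_coeff (P n) = 1"
    and orth: "\<And>j k. j \<noteq> k \<Longrightarrow> moment_functional c s (P j * P k) = 0"
    unfolding monic_orthogonal_def poly_product_integral[OF s] by (fastforce, fastforce, fastforce)
  show "P = mop c s"
  proof
    fix n
    define d where "d = P n - mop c s n"
    have d: "coeff d i = 0" if "i \<ge> n" for i
      using that monic(1)[of n] monic(2)[of n] by (cases "i = n") (auto simp: d_def coeff_eq_0)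
    have "moment_functional c s (d * P n) = 0"
      using monic orth d by (rule orthogonal_lower_degree) auto
    moreover have "moment_functional c s (d * mop c s n) = 0"
      using s d by (rule mop_orthogonal_lower_degree)
    moreover have "d * d = d * P n - d * mop c s n"
      by (simp add: d_def algebra_simps)
    ultimately have "moment_functional c s (d * d) = 0"
      by (simp add: moment_functional_linear)
    then have "d = 0" using moment_functional_square_pos[OF s, of d c] by fastforce
    then show "P n = mop c s n" by (simp add: d_def)
  qed
qed

lemma norm_h_eq: "s > 0 \<Longrightarrow> norm_h c s n = mop_norm c s n"
  by (simp add: norm_h_def orth_poly_eq_mop power2_eq_square poly_product_integral mop_norm_def)

lemma rec_beta_eq: "s > 0 \<Longrightarrow> rec_beta c s n = mop_norm c s n / mop_norm c s (n - 1)"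
  by (simp add: rec_beta_def norm_h_eq)

lemma rec_alpha_eq:
  assumes s: "s > 0"
  shows "rec_alpha c s n = mop_alpha c s n"
  unfolding rec_alpha_def orth_poly_eq_mop[OF s]
proof (rule the_equality)
  have B: "(if n = 0 then 0 else smult (rec_beta c s n) (mop c s (n - 1))) =
    smult (mop_beta c s n) (mop c s (n - 1))"
    by (simp add: rec_beta_eq[OF s] mop_beta_def)
  show *: "[:0, 1:] * mop c s n = mop c s (n + 1) + smult (mop_alpha c s n) (mop c s n)
      + (if n = 0 then 0 else smult (rec_beta c s n) (mop c s (n - 1)))"
    unfolding B by (simp add: mop_Suc)
  fix a
  assume "[:0, 1:] * mop c s n = mop c s (n + 1) + smult a (mop c s n)
      + (if n = 0 then 0 else smult (rec_beta c s n) (mop c s (n - 1)))"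
  then have "smult a (mop c s n) = smult (mop_alpha c s n) (mop c s n)"
    unfolding * by (simp only: add_right_cancel add_left_cancel)
  then have "coeff (smult a (mop c s n)) n = coeff (smult (mop_alpha c s n) (mop c s n)) n"
    by (rule arg_cong)
  then show "a = mop_alpha c s n" by simp
qed

lemma aux_a_eq: "s > 0 \<Longrightarrow>
    aux_a c s n = s * moment_functional (c - 1) s (mop c s n * mop c s n) / mop_norm c s n"
  by (simp only: aux_a_def norm_h_eq orth_poly_eq_mop power2_eq_square poly_product_integral_div)
     simp

lemma aux_b_eq: "s > 0 \<Longrightarrow>
    aux_b c s n = s * moment_functional (c - 1) s (mop c s n * mop c s (n - 1)) / mop_norm c s (n - 1)"
  by (simp only: aux_b_def norm_h_eq orth_poly_eq_mop poly_product_integral_div) simp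

section \<open>Algebraic relations from integration by parts\<close>

lemma rec_alpha_eq_aux_a:
  assumes s: "s > 0"
  shows "rec_alpha c s n = 2 * real n + 1 + c + aux_a c s n"
proof -
  let ?Q = "mop c s n" and ?L = "moment_functional c s"
  have n0: "mop_norm c s n > 0" by (rule mop_norm_pos[OF s])
  \<comment> \<open>x P_n' has degree at most n and x^n-coefficient n. It occurs twice in x
    (P_n^2)', which is the origin of 2n.\<close>
  have "?L (pCons 0 (pderiv ?Q) * ?Q) = real n * mop_norm c s n"
    by (subst mop_leading_part[OF s]) (auto simp only: coeff_pCons_0_pderiv coeff_eq_0 degree_mop
        coeff_mop_same mult_zero_right mult_1_right)
  moreover have "pCons 0 (pderiv (?Q * ?Q)) = pCons 0 (pderiv ?Q) * ?Q + pCons 0 (pderiv ?Q) * ?Q"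
    by (simp add: pderiv_mult mult.commute)
  ultimately have "?L (pCons 0 (pderiv (?Q * ?Q))) = 2 * real n * mop_norm c s n"
    by (simp only: moment_functional_add)
  moreover have "?L (pCons 0 (?Q * ?Q)) = mop_alpha c s n * mop_norm c s n"
    using n0 by (simp add: mop_alpha_def)
  moreover have "s * moment_functional (c - 1) s (?Q * ?Q) = aux_a c s n * mop_norm c s n"
    using n0 by (simp add: aux_a_eq[OF s])
  ultimately have "2 * real n * mop_norm c s n + (c + 1) * mop_norm c s n
     - mop_alpha c s n * mop_norm c s n + aux_a c s n * mop_norm c s n = 0"
    using moment_functional_by_parts[OF s, of c "?Q * ?Q"] by (simp only: mop_norm_def)
  then have "(2 * real n + (c + 1) - mop_alpha c s n + aux_a c s n) * mop_norm c s n = 0"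
    by (simp add: algebra_simps)
  then show ?thesis using n0 by (simp add: rec_alpha_eq[OF s])
qed

lemma aux_b_eq_rec_beta:
  assumes s: "s > 0" and n: "n \<ge> 1"
  shows "aux_b c s n = rec_beta c s n + coeff (mop c s n) (n - 1)"
proof -
  obtain m where m: "n = Suc m" using n by (cases n) auto
  let ?P = "mop c s n" and ?Q = "mop c s m" and ?L = "moment_functional c s"
  have n0: "mop_norm c s m > 0" by (rule mop_norm_pos[OF s])
  \<comment> \<open>Subtracting \<open>n P\<^sub>n\<close> from \<open>x P\<^sub>n'\<close> leaves degree \<open>m\<close> with leading coefficient \<open>- coeff P\<^sub>n m\<close>.\<close>
  define r where "r = pCons 0 (pderiv ?P) - smult (real n) ?P"
  have "?L (r * ?Q) = - coeff ?P m * mop_norm c s m"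
  proof (subst mop_leading_part[OF s])
    fix i assume "i > m"
    then show "coeff r i = 0" by (cases "i = n")
      (auto simp del: coeff_pCons_Suc simp: r_def coeff_pCons_0_pderiv coeff_eq_0 m)
  next
    show "coeff r m * mop_norm c s m = - coeff ?P m * mop_norm c s m"
      by (simp add: r_def coeff_pCons_0_pderiv m algebra_simps)
  qed
  moreover have "?L (?P * ?Q) = 0" by (rule mop_orthogonal[OF s]) (simp add: m)
  moreover have "?L (pCons 0 (pderiv ?Q) * ?P) = 0"
    by (rule mop_orthogonal_lower_degree[OF s]) (simp add: coeff_pCons_0_pderiv m coeff_eq_0)
  moreover have "pCons 0 (pderiv (?P * ?Q)) = r * ?Q + smult (real n) (?P * ?Q) + pCons 0 (pderiv ?Q) * ?P"
    by (simp add: pderiv_mult r_def algebra_simps)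
  ultimately have 1: "?L (pCons 0 (pderiv (?P * ?Q))) = - coeff ?P m * mop_norm c s m"
    by (simp only: moment_functional_linear)
  \<comment> \<open>x P_m is monic of degree n, so this pairing is h_n, and division by h_m turns it
    into beta_n.\<close>
  have "?L (pCons 0 ?Q * ?P) = coeff (pCons 0 ?Q) n * mop_norm c s n"
    by (rule mop_leading_part[OF s]) (simp add: m coeff_eq_0 coeff_pCons split: nat.splits)
  then have 2: "?L (pCons 0 (?P * ?Q)) = mop_norm c s n"
    by (simp add: m mult.commute)
  have 3: "s * moment_functional (c - 1) s (?P * ?Q) = aux_b c s n * mop_norm c s m"
    using n0 by (simp add: aux_b_eq[OF s] m)
  have "- coeff ?P m * mop_norm c s m - mop_norm c s n + aux_b c s n * mop_norm c s m = 0"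
    using moment_functional_by_parts[OF s, of c "?P * ?Q"] \<open>?L (?P * ?Q) = 0\<close>
    by (simp only: 1 2 3)
  then show ?thesis using n0 by (simp add: rec_beta_eq[OF s] m field_simps)
qed

text \<open>Comparison of the coefficients of x^n in \<open>mop_Suc\<close>, out of reach of the
  \<open>mop_beta\<close> term. At n = 0 the truncated index n - 1 would pick the leading
  coefficient 1 instead of 0.\<close>

lemma mop_alpha_eq_coeff:
  assumes "n \<ge> 1"
  shows "mop_alpha c s n = coeff (mop c s n) (n - 1) - coeff (mop c s (Suc n)) n"
  using assms by (cases n) (simp_all add: mop_Suc[of c s n] mop_Suc[of c s "Suc m" for m] coeff_eq_0)

section \<open>Dependence on the parameter\<close>

text \<open>The degree bound must be uniform in \<open>t\<close>: it makes \<open>moment_functional\<close> a fixed finite sum.\<close>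

definition has_poly_derivative :: "(real \<Rightarrow> real poly) \<Rightarrow> real poly \<Rightarrow> real \<Rightarrow> bool" where
  "has_poly_derivative p p' s \<longleftrightarrow> (\<exists>N. \<forall>t. degree (p t) \<le> N) \<and>
     (\<forall>i. ((\<lambda>t. coeff (p t) i) has_real_derivative coeff p' i) (at s))"

lemma has_poly_derivative_const: "has_poly_derivative (\<lambda>t. p) 0 s"
  by (auto simp: has_poly_derivative_def)

lemma has_poly_derivative_pCons_0:
  assumes "has_poly_derivative p p' s"
  shows "has_poly_derivative (\<lambda>t. pCons 0 (p t)) (pCons 0 p') s"
proof -
  obtain N where "\<forall>t. degree (p t) \<le> N"
    using assms by (auto simp: has_poly_derivative_def)
  then have "\<forall>t. degree (pCons 0 (p t)) \<le> Suc N"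
    by (simp add: degree_pCons_eq_if)
  then have "\<exists>N. \<forall>t. degree (pCons 0 (p t)) \<le> N" ..
  moreover have "((\<lambda>t. coeff (pCons 0 (p t)) i) has_real_derivative coeff (pCons 0 p') i) (at s)" for i
    using assms by (cases i) (auto simp: has_poly_derivative_def)
  ultimately show ?thesis unfolding has_poly_derivative_def by blast
qed

lemma has_poly_derivative_diff:
  assumes "has_poly_derivative p p' s" "has_poly_derivative q q' s"
  shows "has_poly_derivative (\<lambda>t. p t - q t) (p' - q') s"
proof -
  obtain M N where "\<forall>t. degree (p t) \<le> M" "\<forall>t. degree (q t) \<le> N"
    using assms by (auto simp: has_poly_derivative_def)
  then have "\<forall>t. degree (p t - q t) \<le> max M N"
    by (intro allI degree_diff_le) (auto simp: le_max_iff_disj)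
  then show ?thesis
    using assms by (auto simp: has_poly_derivative_def intro!: DERIV_diff)
qed

lemma has_poly_derivative_mult:
  assumes p: "has_poly_derivative p p' s" and q: "has_poly_derivative q q' s"
  shows "has_poly_derivative (\<lambda>t. p t * q t) (p' * q s + p s * q') s"
proof -
  obtain M N where "\<forall>t. degree (p t) \<le> M" "\<forall>t. degree (q t) \<le> N"
    using assms by (auto simp: has_poly_derivative_def)
  then have "\<forall>t. degree (p t * q t) \<le> M + N"
    by (intro allI order_trans[OF degree_mult_le]) (auto intro: add_mono)
  moreover have "((\<lambda>t. coeff (p t * q t) i) has_real_derivative coeff (p' * q s + p s * q') i) (at s)" for i
  proof -
    have "((\<lambda>t. \<Sum>j\<le>i. coeff (p t) j * coeff (q t) (i - j)) has_real_derivative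
      (\<Sum>j\<le>i. coeff p' j * coeff (q s) (i - j) + coeff q' (i - j) * coeff (p s) j)) (at s)"
      using assms by (intro DERIV_sum DERIV_mult) (auto simp: has_poly_derivative_def)
    also have "(\<Sum>j\<le>i. coeff p' j * coeff (q s) (i - j) + coeff q' (i - j) * coeff (p s) j) =
      coeff (p' * q s + p s * q') i"
      by (simp add: coeff_mult sum.distrib mult.commute[of "coeff q' j" for j])
    finally show ?thesis by (simp add: coeff_mult)
  qed
  ultimately show ?thesis by (auto simp: has_poly_derivative_def)
qed

lemma has_poly_derivative_smult:
  assumes f: "(f has_real_derivative f') (at s)" and p: "has_poly_derivative p p' s"
  shows "has_poly_derivative (\<lambda>t. smult (f t) (p t)) (smult f' (p s) + smult (f s) p') s"
proof -
  have "has_poly_derivative (\<lambda>t. [:f t:]) [:f':] s"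
    using f by (auto simp: has_poly_derivative_def coeff_pCons split: nat.splits)
  from has_poly_derivative_mult[OF this p] show ?thesis by simp
qed

text \<open>Product rule: \<open>p'\<close> comes from the coefficients, the exponent
  \<open>c - 1\<close> from differentiating the weight.\<close>

lemma moment_functional_has_derivative:
  assumes s: "s > 0" and p: "has_poly_derivative p p' s"
  shows "((\<lambda>t. moment_functional c t (p t)) has_real_derivative
     moment_functional c s p' - moment_functional (c - 1) s (p s)) (at s)"
proof -
  obtain N where N: "\<And>t. degree (p t) \<le> N"
    using p by (auto simp: has_poly_derivative_def)
  have "coeff p' i = 0" if "i > N" for i
  proof (rule DERIV_unique)
    show "((\<lambda>t. coeff (p t) i) has_real_derivative coeff p' i) (at s)"
      using p by (simp add: has_poly_derivative_def)
    have "coeff (p t) i = 0" for t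
      using N[of t] that by (intro coeff_eq_0) simp
    then show "((\<lambda>t. coeff (p t) i) has_real_derivative 0) (at s)" by simp
  qed
  then have N': "degree p' \<le> N" by (intro degree_le) auto
  have "((\<lambda>t. \<Sum>i\<le>N. coeff (p t) i * moment (c + real i) t) has_real_derivative
     (\<Sum>i\<le>N. coeff p' i * moment (c + real i) s + - moment (c + real i - 1) s * coeff (p s) i)) (at s)"
    using p by (intro DERIV_sum DERIV_mult moment_has_derivative[OF s]) (auto simp: has_poly_derivative_def)
  then show ?thesis
    by (simp add: moment_functional_altdef[OF N] moment_functional_altdef[OF N'] sum_subtractf
        algebra_simps)
qed

text \<open>The recurrence coefficients are quotients of moment functionals of earlier polynomials
  with nonzero denominators at \<open>s\<close>, so differentiability propagates. Bare existence
  suffices: orthogonality later yields the one coefficient of the derivative that matters.\<close>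

lemma mop_has_poly_derivative:
  assumes s: "s > 0"
  shows "\<exists>D. has_poly_derivative (\<lambda>t. mop c t n) D s"
proof (induction n rule: less_induct)
  case (less n)
  show ?case
  proof (cases n)
    case 0
    then show ?thesis using has_poly_derivative_const by auto
  next
    case (Suc m)
    obtain D E where D: "has_poly_derivative (\<lambda>t. mop c t m) D s"
      and E: "has_poly_derivative (\<lambda>t. mop c t (m - 1)) E s"
      using less[of m] less[of "m - 1"] Suc by (auto simp: less_Suc_eq_le)
    have nz: "mop_norm c s k \<noteq> 0" for k using mop_norm_pos[OF s, of c k] by simp
    obtain h where h: "((\<lambda>t. mop_norm c t m) has_real_derivative h) (at s)"
      unfolding mop_norm_def
      using moment_functional_has_derivative[OF s has_poly_derivative_mult[OF D D]] by blast
    obtain h1 where h1: "((\<lambda>t. mop_norm c t (m - 1)) has_real_derivative h1) (at s)"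
      unfolding mop_norm_def
      using moment_functional_has_derivative[OF s has_poly_derivative_mult[OF E E]] by blast
    obtain a where a: "((\<lambda>t. mop_alpha c t m) has_real_derivative a) (at s)"
      unfolding mop_alpha_def
      using DERIV_divide[OF moment_functional_has_derivative[OF s
        has_poly_derivative_pCons_0[OF has_poly_derivative_mult[OF D D]]] h nz] by blast
    have "\<exists>b. ((\<lambda>t. mop_beta c t m) has_real_derivative b) (at s)"
    proof (cases "m = 0")
      case True
      then show ?thesis by (auto simp: mop_beta_def intro: exI[of _ 0])
    next
      case False
      then show ?thesis using DERIV_divide[OF h h1 nz] by (auto simp: mop_beta_def)
    qed
    then obtain b where b: "((\<lambda>t. mop_beta c t m) has_real_derivative b) (at s)" by blast
    show ?thesis
      unfolding Suc mop_Suc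
      using has_poly_derivative_diff[OF has_poly_derivative_diff[OF has_poly_derivative_pCons_0[OF D]
        has_poly_derivative_smult[OF a D]] has_poly_derivative_smult[OF b E]] by blast
  qed
qed

text \<open>As \<open>mop c t n\<close> is monic for every \<open>t\<close>, its derivative in \<open>t\<close> has degree less than \<open>n\<close>.\<close>

lemma mop_derivative_coeff:
  assumes "has_poly_derivative (\<lambda>t. mop c t n) D s" "i \<ge> n"
  shows "coeff D i = 0"
proof (rule DERIV_unique)
  show "((\<lambda>t. coeff (mop c t n) i) has_real_derivative coeff D i) (at s)"
    using assms by (simp add: has_poly_derivative_def)
  have "coeff (mop c t n) i = (if i = n then 1 else 0)" for t
    using assms(2) by (auto simp: coeff_eq_0)
  then show "((\<lambda>t. coeff (mop c t n) i) has_real_derivative 0) (at s)" by simp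
qed

section \<open>The differential equations\<close>

lemma mop_norm_has_derivative:
  assumes s: "s > 0"
  shows "((\<lambda>t. mop_norm c t n) has_real_derivative
    - moment_functional (c - 1) s (mop c s n * mop c s n)) (at s)"
proof -
  obtain D where D: "has_poly_derivative (\<lambda>t. mop c t n) D s"
    using mop_has_poly_derivative[OF s] by blast
  have "moment_functional c s (D * mop c s n) = 0"
    using s mop_derivative_coeff[OF D] by (rule mop_orthogonal_lower_degree)
  then have "moment_functional c s (D * mop c s n + mop c s n * D) = 0"
    by (simp only: moment_functional_add mult.commute[of "mop c s n"])
  then show ?thesis
    using moment_functional_has_derivative[OF s has_poly_derivative_mult[OF D D], of c]
    by (simp add: mop_norm_def)
qed

lemma mop_subleading_has_derivative:
  assumes s: "s > 0"
  shows "((\<lambda>t. coeff (mop c t (Suc m)) m) has_real_derivative aux_b c s (Suc m) / s) (at s)"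
proof -
  obtain D E where D: "has_poly_derivative (\<lambda>t. mop c t (Suc m)) D s"
    and E: "has_poly_derivative (\<lambda>t. mop c t m) E s"
    using mop_has_poly_derivative[OF s] by metis
  have "moment_functional c s (D * mop c s m) = coeff D m * mop_norm c s m"
    using mop_derivative_coeff[OF D] by (intro mop_leading_part[OF s]) auto
  moreover have "moment_functional c s (E * mop c s (Suc m)) = 0"
    using mop_derivative_coeff[OF E] by (intro mop_orthogonal_lower_degree[OF s]) auto
  ultimately have d: "((\<lambda>t. moment_functional c t (mop c t (Suc m) * mop c t m)) has_real_derivative
     coeff D m * mop_norm c s m - moment_functional (c - 1) s (mop c s (Suc m) * mop c s m)) (at s)"
    using moment_functional_has_derivative[OF s has_poly_derivative_mult[OF D E], of c]
    by (simp add: moment_functional_linear mult.commute)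
  \<comment> \<open>Orthogonality at every t > 0 makes the function differentiated above vanish near
    \<open>s\<close>, so its derivative is 0; this determines \<open>coeff D m\<close>.\<close>
  have "((\<lambda>t. 0) has_real_derivative
     coeff D m * mop_norm c s m - moment_functional (c - 1) s (mop c s (Suc m) * mop c s m)) (at s)"
    by (rule has_field_derivative_transform_within_open[OF d, of "{0<..}"])
       (auto simp: s mop_orthogonal)
  then have "coeff D m * mop_norm c s m - moment_functional (c - 1) s (mop c s (Suc m) * mop c s m) = 0"
    by (rule DERIV_unique) simp
  then have "coeff D m = aux_b c s (Suc m) / s"
    using mop_norm_pos[OF s, of c m] s by (simp add: aux_b_eq[OF s] field_simps)
  then show ?thesis using D by (metis has_poly_derivative_def)
qed

lemma ln_rec_beta_has_derivative:
  assumes s: "s > 0"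
  shows "((\<lambda>t. ln (rec_beta c t n)) has_real_derivative
     (aux_a c s (n - 1) - aux_a c s n) / s) (at s)"
proof -
  have ln: "((\<lambda>t. ln (mop_norm c t k)) has_real_derivative - aux_a c s k / s) (at s)" for k
    using DERIV_chain2[OF DERIV_ln[OF mop_norm_pos[OF s, of c k]] mop_norm_has_derivative[OF s, of c k]] s
    by (simp add: aux_a_eq[OF s] field_simps)
  have "((\<lambda>t. ln (mop_norm c t n) - ln (mop_norm c t (n - 1))) has_real_derivative
     - aux_a c s n / s - - aux_a c s (n - 1) / s) (at s)"
    by (intro DERIV_diff ln)
  \<comment> \<open>The formula for \<open>rec_beta\<close> is available for t > 0 only; this open
    set contains \<open>s\<close>, which is enough for a derivative at \<open>s\<close>.\<close>
  then have "((\<lambda>t. ln (rec_beta c t n)) has_real_derivative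
     - aux_a c s n / s - - aux_a c s (n - 1) / s) (at s)"
    by (rule has_field_derivative_transform_within_open[of _ _ _ "{0<..}"])
       (auto simp: s rec_beta_eq ln_divide_pos mop_norm_pos)
  then show ?thesis by (simp add: diff_divide_distrib)
qed

lemma rec_alpha_has_derivative:
  assumes s: "s > 0" and n: "n \<ge> 1"
  shows "((\<lambda>t. rec_alpha c t n) has_real_derivative (aux_b c s n - aux_b c s (n + 1)) / s) (at s)"
proof -
  obtain m where m: "n = Suc m" using n by (cases n) auto
  have "((\<lambda>t. coeff (mop c t n) m - coeff (mop c t (Suc n)) n) has_real_derivative
     aux_b c s n / s - aux_b c s (Suc n) / s) (at s)"
    unfolding m by (intro DERIV_diff mop_subleading_has_derivative[OF s])
  then have "((\<lambda>t. rec_alpha c t n) has_real_derivative aux_b c s n / s - aux_b c s (Suc n) / s) (at s)"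
    by (rule has_field_derivative_transform_within_open[of _ _ _ "{0<..}"])
       (auto simp: s m rec_alpha_eq mop_alpha_eq_coeff)
  then show ?thesis by (simp add: diff_divide_distrib)
qed

lemma aux_a_has_derivative:
  assumes s: "s > 0" and n: "n \<ge> 1"
  shows "((\<lambda>t. aux_a c t n) has_real_derivative (aux_b c s n - aux_b c s (n + 1)) / s) (at s)"
proof -
  \<comment> \<open>By \<open>rec_alpha_eq_aux_a\<close> this function agrees with a_n for t > 0, so
    a_n inherits the derivative of alpha_n.\<close>
  have "((\<lambda>t. rec_alpha c t n - (2 * real n + 1 + c)) has_real_derivative
      (aux_b c s n - aux_b c s (n + 1)) / s - 0) (at s)"
    by (intro DERIV_diff rec_alpha_has_derivative s n DERIV_const)
  then have "((\<lambda>t. aux_a c t n) has_real_derivative (aux_b c s n - aux_b c s (n + 1)) / s - 0) (at s)"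
    by (rule has_field_derivative_transform_within_open[of _ _ _ "{0<..}"])
       (auto simp: s rec_alpha_eq_aux_a)
  then show ?thesis by simp
qed

theorem mainTheorem7:
  fixes \<alpha> s :: real and n :: nat
  assumes "\<alpha> > 0" and "s > 0" and "n \<ge> 1"
  shows
    "((\<lambda>t. ln (rec_beta \<alpha> t n)) field_differentiable (at s)
      \<and> s * deriv (\<lambda>t. ln (rec_beta \<alpha> t n)) s = aux_a \<alpha> s (n - 1) - aux_a \<alpha> s n)
    \<and> ((\<lambda>t. rec_alpha \<alpha> t n) field_differentiable (at s)
      \<and> (\<lambda>t. aux_a \<alpha> t n) field_differentiable (at s)
      \<and> s * deriv (\<lambda>t. rec_alpha \<alpha> t n) s = s * deriv (\<lambda>t. aux_a \<alpha> t n) s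
      \<and> s * deriv (\<lambda>t. aux_a \<alpha> t n) s = aux_b \<alpha> s n - aux_b \<alpha> s (n + 1)
      \<and> aux_b \<alpha> s n - aux_b \<alpha> s (n + 1)
          = rec_beta \<alpha> s n - rec_beta \<alpha> s (n + 1) + rec_alpha \<alpha> s n)"
proof -
  note s = assms(2) and n = assms(3)
  note d = ln_rec_beta_has_derivative[OF s, of \<alpha> n] rec_alpha_has_derivative[OF s n, of \<alpha>]
    aux_a_has_derivative[OF s n, of \<alpha>]
  \<comment> \<open>The subleading coefficients in the formulas for b_n and b_(n+1) differ by
    exactly alpha_n.\<close>
  have "aux_b \<alpha> s n - aux_b \<alpha> s (n + 1) = rec_beta \<alpha> s n - rec_beta \<alpha> s (n + 1) + rec_alpha \<alpha> s n"
    using n by (simp add: aux_b_eq_rec_beta[OF s] rec_alpha_eq[OF s] mop_alpha_eq_coeff)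
  moreover have "(\<lambda>t. ln (rec_beta \<alpha> t n)) field_differentiable (at s)"
    "(\<lambda>t. rec_alpha \<alpha> t n) field_differentiable (at s)"
    "(\<lambda>t. aux_a \<alpha> t n) field_differentiable (at s)"
    using d by (auto simp: field_differentiable_def)
  ultimately show ?thesis
    using s by (simp add: d[THEN DERIV_imp_deriv])
qed

end
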